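(* Fix integers $t\ge 2$ and $s_1,s_2,\dots,s_t\ge 3$, and for $1\le i\le t$ set $m_i=R(s_1,\dots,s_{i-1},s_i-1,s_{i+1},\dots,s_t)$. Suppose $m_1\ge m_j$ for all $j\ge 2$. Then for every positive integer $r$, $$R^{\mathrm{KG}}_r(s_1,\dots,s_t)\le (m_1+1)r+\sum_{i=2}^{t}(m_i-1).$$
   Context: The multicolor Ramsey number $R(s_1,\dots,s_t)$ is the minimum $n$ such that in every $t$-coloring of the edges of $K_n$ there is, for some $i\in[t]$, a clique $K_{s_i}$ all of whose edges have color $i$. The Kneser graph $\mathrm{KG}(n,r)$ has vertex set the $r$-element subsets of $[n]=\{1,\dots,n\}$, with two sets adjacent iff they are disjoint. The multicolor $r$-Kneser Ramsey number $R^{\mathrm{KG}}_r(s_1,\dots,s_t)$ is the minimum $n$ such that in every $t$-coloring of the edges of $\mathrm{KG}(n,r)$ there is, for some $i\in[t]$, a set of $s_i$ pairwise adjacent vertices all of whose connecting edges have color $i$. *)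

theory Defs
  imports "HOL-Library.Ramsey"
begin

text \<open>
  A tuple \<open>(s\<^sub>1, \<dots>, s\<^sub>t)\<close> is a list \<open>s\<close> of length \<open>t\<close>; its entries, and the \<open>t\<close> colors,
  are indexed from 0, so \<open>s\<^sub>i\<close> is \<open>s ! (i - 1)\<close>.
  Edges are two-element sets of vertices, and a coloring is constrained only on the edges.
\<close>

definition ramsey_number :: "nat list \<Rightarrow> nat" where
  "ramsey_number s = (LEAST n. partn_lst {..<n} s 2)"

text \<open>The set over which \<open>LEAST\<close> ranges is nonempty by Ramsey's theorem.\<close>

lemma partn_lst_ramsey_number: "partn_lst {..<ramsey_number s} s 2"
  unfolding ramsey_number_def using ramsey_full[of s 2] by (rule LeastI_ex)

definition kneser_verts :: "nat \<Rightarrow> nat \<Rightarrow> nat set set" where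
  "kneser_verts n r = nsets {1..n} r"

text \<open>For \<open>r > 0\<close> disjoint \<open>r\<close>-sets are distinct, so there are no loops.\<close>

definition kneser_edges :: "nat \<Rightarrow> nat \<Rightarrow> nat set set set" where
  "kneser_edges n r =
    {{A, B} | A B. A \<in> kneser_verts n r \<and> B \<in> kneser_verts n r \<and> A \<inter> B = {}}"

definition kneser_arrows :: "nat \<Rightarrow> nat \<Rightarrow> nat list \<Rightarrow> bool" where
  "kneser_arrows n r s \<longleftrightarrow>
    (\<forall>f \<in> kneser_edges n r \<rightarrow> {..<length s}. \<exists>i < length s.
      \<exists>K \<in> nsets (kneser_verts n r) (s ! i).
        clique K (kneser_edges n r) \<and> (\<forall>e \<in> nsets K 2. f e = i))"

definition kneser_ramsey_number :: "nat \<Rightarrow> nat list \<Rightarrow> nat" where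
  "kneser_ramsey_number r s = (LEAST n. kneser_arrows n r s)"

end

theory Submission
  imports Defs "HOL-Library.Sublist" "HOL-Library.Disjoint_Sets" "HOL-Number_Theory.Cong"
begin

text \<open>
  Color each \<open>r\<close>-set disjoint from a fixed vertex \<open>A0\<close> of the Kneser graph by the color of its edge to
  \<open>A0\<close>. By an unequal-sizes form of the Alon--Frankl--Lovasz theorem, the remaining
  \<open>m 0 * r + (\<Sum>i = 1..<t. m i - 1)\<close> points contain, for some color \<open>c\<close>, \<open>m c\<close> pairwise disjoint
  \<open>r\<close>-sets of color \<open>c\<close>, and Ramsey's theorem applies to the clique they form.

  The Alon--Frankl--Lovasz theorem for matchings of prime size \<open>p\<close> follows from the nonexistence of
  equivariant maps from the join of \<open>n\<close> copies of the cyclic group of order \<open>p\<close> to the join of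
  fewer copies: \<open>p\<close> disjoint sets of points are sent to the set of pairs (color, part) that occur,
  or, when no part contains an \<open>r\<close>-set, to their total size and the part of the top point. The
  nonexistence is a computation with integral cochains. Pulling back the periodic resolution along
  the map gives cochains linked by the norm and difference operators; evaluated on iterated cones
  they give numbers whose divisibility by the group order passes down from degree \<open>n\<close> to degree 1,
  where the value is 1. But the degree \<open>n\<close> cochain vanishes if there are fewer than \<open>n\<close> levels.
\<close>

subsection \<open>Coboundaries and subdivision\<close>

text \<open>The simplicial coboundary, an alternating sum over the deletions of one entry, in
  augmented form: on a singleton its value is \<open>\<phi> []\<close>.\<close>

primrec delta :: "('a list \<Rightarrow> int) \<Rightarrow> 'a list \<Rightarrow> int" where
  "delta \<phi> [] = 0"
| "delta \<phi> (x # L) = \<phi> L - delta (\<lambda>L. \<phi> (x # L)) L"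

lemma delta_diff: "delta (\<lambda>L. \<phi> L - \<psi> L) = (\<lambda>X. delta \<phi> X - delta \<psi> X)"
proof
  show "delta (\<lambda>L. \<phi> L - \<psi> L) X = delta \<phi> X - delta \<psi> X" for X
    by (induction X arbitrary: \<phi> \<psi>) auto
qed

lemma delta_scale: "delta (\<lambda>L. c * \<phi> L) = (\<lambda>X. c * delta \<phi> X)"
proof
  show "delta (\<lambda>L. c * \<phi> L) X = c * delta \<phi> X" for X
    by (induction X arbitrary: \<phi>) (auto simp: algebra_simps)
qed

lemma delta_sum: "delta (\<lambda>L. \<Sum>a\<in>I. \<phi> a L) = (\<lambda>X. \<Sum>a\<in>I. delta (\<phi> a) X)"
proof
  show "delta (\<lambda>L. \<Sum>a\<in>I. \<phi> a L) X = (\<Sum>a\<in>I. delta (\<phi> a) X)" for X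
    by (induction X arbitrary: \<phi>) (auto simp: sum_subtractf)
qed

lemma delta_delta [simp]: "delta (delta \<phi>) X = 0"
  by (induction X arbitrary: \<phi>) (auto simp: delta_diff)

lemma delta_map: "delta (\<lambda>L. \<phi> (map g L)) = (\<lambda>X. delta \<phi> (map g X))"
proof
  show "delta (\<lambda>L. \<phi> (map g L)) X = delta \<phi> (map g X)" for X
    by (induction X arbitrary: \<phi>) auto
qed

lemma delta_cong:
  assumes "\<And>Y. subseq Y X \<Longrightarrow> Suc (length Y) = length X \<Longrightarrow> \<phi> Y = \<psi> Y"
  shows "delta \<phi> X = delta \<psi> X"
  using assms
proof (induction X arbitrary: \<phi> \<psi>)
  case (Cons x X)
  have "delta (\<lambda>L. \<phi> (x # L)) X = delta (\<lambda>L. \<psi> (x # L)) X"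
    by (rule Cons.IH) (simp add: Cons.prems)
  moreover have "\<phi> X = \<psi> X"
    by (rule Cons.prems) auto
  ultimately show ?case by simp
qed simp

text \<open>
  The pullback of a cochain along barycentric subdivision: a signed sum over the maximal flags
  of faces of \<open>X\<close>, listed from \<open>X\<close> downwards. The first argument is the number of vertices of \<open>X\<close>.
\<close>

primrec sd :: "nat \<Rightarrow> ('a list list \<Rightarrow> int) \<Rightarrow> 'a list \<Rightarrow> int" where
  "sd 0 \<phi> X = \<phi> []"
| "sd (Suc j) \<phi> X = delta (sd j (\<lambda>L. \<phi> (X # L))) X"

lemma sd_diff: "sd j (\<lambda>L. \<phi> L - \<psi> L) = (\<lambda>X. sd j \<phi> X - sd j \<psi> X)"
proof (induction j arbitrary: \<phi> \<psi>)
  case (Suc j)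
  show ?case by (rule ext) (simp add: Suc delta_diff)
qed auto

lemma sd_scale: "sd j (\<lambda>L. c * \<phi> L) = (\<lambda>X. c * sd j \<phi> X)"
proof (induction j arbitrary: \<phi>)
  case (Suc j)
  show ?case by (rule ext) (simp add: Suc delta_scale)
qed auto

lemma sd_sum: "sd j (\<lambda>L. \<Sum>a\<in>I. \<phi> a L) = (\<lambda>X. \<Sum>a\<in>I. sd j (\<phi> a) X)"
proof (induction j arbitrary: \<phi>)
  case (Suc j)
  show ?case by (rule ext) (simp add: Suc delta_sum)
qed auto

lemma sd_map: "sd j (\<lambda>L. \<phi> (map (map g) L)) = (\<lambda>X. sd j \<phi> (map g X))"
proof (induction j arbitrary: \<phi>)
  case (Suc j)
  show ?case
  proof
    fix X
    show "sd (Suc j) (\<lambda>L. \<phi> (map (map g) L)) X = sd (Suc j) \<phi> (map g X)"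
      using Suc[of "\<lambda>L. \<phi> (map g X # L)"]
      by (simp add: delta_map[of _ g])
  qed
qed auto

text \<open>Subdivision is a chain map. Deleting the top face \<open>X\<close> of a flag leaves a
  flag of a facet; by induction the other deletions add up to a coboundary, which the outer
  \<open>delta\<close> kills.\<close>

lemma sd_delta: "sd (Suc j) (delta \<phi>) = delta (sd j \<phi>)"
proof (induction j arbitrary: \<phi>)
  case 0
  show ?case
  proof
    have "sd 0 \<phi> = (\<lambda>_. \<phi> [])" "\<And>X. sd 0 (\<lambda>L. delta \<phi> (X # L)) = (\<lambda>_. \<phi> [])"
      by auto
    then show "sd (Suc 0) (delta \<phi>) X = delta (sd 0 \<phi>) X" for X
      by (simp del: sd.simps(1))
  qed
next
  case (Suc j)
  show ?case
  proof
    fix X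
    have "sd (Suc (Suc j)) (delta \<phi>) X =
        delta (\<lambda>Y. sd (Suc j) \<phi> Y - sd (Suc j) (delta (\<lambda>L. \<phi> (X # L))) Y) X"
      by (subst sd.simps(2)) (simp add: sd_diff del: sd.simps(2))
    also have "\<dots> = delta (sd (Suc j) \<phi>) X"
      by (simp add: Suc delta_diff del: sd.simps(2))
    finally show "sd (Suc (Suc j)) (delta \<phi>) X = delta (sd (Suc j) \<phi>) X" .
  qed
qed

definition flag :: "'a list \<Rightarrow> 'a list list \<Rightarrow> bool" where
  "flag X L \<longleftrightarrow> sorted_wrt (\<lambda>A B. subseq B A) L \<and> (\<forall>Y \<in> set L. Y \<noteq> [] \<and> subseq Y X)"

text \<open>Each step of the recursion passes to a facet, so only flags of \<open>j\<close> faces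
  enter. Identities that hold only on faces can thus be used under \<open>sd\<close>.\<close>

lemma sd_cong:
  assumes "length X = j" "\<And>L. length L = j \<Longrightarrow> flag X L \<Longrightarrow> \<phi> L = \<psi> L"
  shows "sd j \<phi> X = sd j \<psi> X"
  using assms
proof (induction j arbitrary: \<phi> \<psi> X)
  case 0
  then show ?case by (simp add: flag_def)
next
  case (Suc j)
  have "sd j (\<lambda>L. \<phi> (X # L)) Y = sd j (\<lambda>L. \<psi> (X # L)) Y"
    if Y: "subseq Y X" "Suc (length Y) = length X" for Y
  proof (rule Suc.IH)
    show "length Y = j" using Y Suc.prems by simp
    fix L assume L: "length L = j" "flag Y L"
    have "flag X (X # L)"
      using L Y Suc.prems(1) by (auto simp: flag_def intro: subseq_order.trans)
    then show "\<phi> (X # L) = \<psi> (X # L)" using L Suc.prems(2) by simp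
  qed
  then show ?case by (auto intro: delta_cong)
qed

subsection \<open>Cyclic group actions\<close>

text \<open>The action of the element \<open>\<Sum>a<k. w a g\<^sup>a\<close> of a group ring, where \<open>g\<close> acts as \<open>s\<close>.\<close>

definition act :: "nat \<Rightarrow> (nat \<Rightarrow> int) \<Rightarrow> ('b \<Rightarrow> 'b) \<Rightarrow> ('b \<Rightarrow> int) \<Rightarrow> 'b \<Rightarrow> int" where
  "act k w s V X = (\<Sum>a<k. w a * V ((s ^^ a) X))"

abbreviation norm_op :: "nat \<Rightarrow> ('b \<Rightarrow> 'b) \<Rightarrow> ('b \<Rightarrow> int) \<Rightarrow> 'b \<Rightarrow> int" where
  "norm_op k \<equiv> act k (\<lambda>_. 1)"

definition diff_op :: "('b \<Rightarrow> 'b) \<Rightarrow> ('b \<Rightarrow> int) \<Rightarrow> 'b \<Rightarrow> int" where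
  "diff_op s V X = V (s X) - V X"

lemma map_funpow: "map g ^^ a = map (g ^^ a)" for g :: "'a \<Rightarrow> 'a"
  by (induction a) auto

lemma delta_act: "delta (act k w (map g) V) = act k w (map g) (delta V)"
  by (simp add: fun_eq_iff act_def[abs_def] delta_sum delta_scale map_funpow delta_map)

lemma delta_diff_op: "delta (diff_op (map g) V) = diff_op (map g) (delta V)"
  by (simp add: fun_eq_iff diff_op_def[abs_def] delta_diff delta_map)

lemma sd_act: "sd j (act k w (map (map g)) V) = act k w (map g) (sd j V)"
  by (simp add: fun_eq_iff act_def[abs_def] sd_sum sd_scale map_funpow sd_map)

lemma sd_diff_op: "sd j (diff_op (map (map g)) V) = diff_op (map g) (sd j V)"
  by (simp add: fun_eq_iff diff_op_def[abs_def] sd_diff sd_map)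

lemma act_diff_op: "act k w s (diff_op s V) = diff_op s (act k w s V)"
  by (auto simp: fun_eq_iff act_def diff_op_def sum_subtractf algebra_simps funpow_swap1)

text \<open>In the group ring, (g - 1) times the sum of a g^a over a < k telescopes to k minus the
  norm element, since g^k = 1.\<close>

lemma diff_op_act_linear:
  assumes "(s ^^ k) X = X"
  shows "diff_op s (act k int s V) X = int k * V X - norm_op k s V X"
proof -
  have "(\<Sum>a<k. int a * V ((s ^^ a) (s X))) - (\<Sum>a<k. int a * V ((s ^^ a) X)) =
      int k * V ((s ^^ k) X) - (\<Sum>a<k. V ((s ^^ Suc a) X))"
    by (induction k) (auto simp: algebra_simps funpow_swap1)
  also have "(\<Sum>a<k. V ((s ^^ Suc a) X)) = (\<Sum>a<k. V ((s ^^ a) X)) + V ((s ^^ k) X) - V X"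
    by (induction k) auto
  finally show ?thesis
    using assms by (simp add: diff_op_def act_def)
qed

lemma diff_op_norm_op:
  assumes "(s ^^ k) X = X"
  shows "diff_op s (norm_op k s V) X = 0"
proof -
  have "(\<Sum>a<k. V ((s ^^ a) (s X))) - (\<Sum>a<k. V ((s ^^ a) X)) = V ((s ^^ k) X) - V X"
    by (induction k) (auto simp: funpow_swap1)
  then show ?thesis using assms by (simp add: diff_op_def act_def)
qed

text \<open>On values at least \<open>k\<close> the rotation is the identity, so that its order divides \<open>k\<close> everywhere.\<close>

definition rot :: "nat \<Rightarrow> nat \<times> nat \<Rightarrow> nat \<times> nat" where
  "rot k = (\<lambda>(i, a). (i, if a < k then Suc a mod k else a))"

lemma funpow_rot: "(rot k ^^ b) (i, a) = (i, if a < k then (a + b) mod k else a)"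
  by (induction b) (auto simp: rot_def mod_Suc_eq)

lemma map_rot_funpow: "(map (rot k) ^^ k) X = X"
proof -
  have "rot k ^^ k = id" by (auto simp: fun_eq_iff funpow_rot)
  then show ?thesis by (simp add: map_funpow)
qed

text \<open>The alternating differentials of the periodic resolution, g - 1 and the norm; the
  identity at \<open>j = 0\<close> makes the first cone the single vertex
  \<open>(0, 0)\<close>.\<close>

definition cone_op :: "nat \<Rightarrow> nat \<Rightarrow> ((nat \<times> nat) list \<Rightarrow> int) \<Rightarrow> (nat \<times> nat) list \<Rightarrow> int" where
  "cone_op k j = (if j = 0 then id else if odd j then diff_op (map (rot k)) else norm_op k (map (rot k)))"

text \<open>
  Evaluation on a chain of dimension \<open>j - 1\<close> in the join of \<open>j\<close> copies of the cyclic group of order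
  \<open>k\<close>. Each chain is the cone, with apex the neutral element of a fresh copy, over the previous
  one multiplied by \<open>g - 1\<close> or by the norm element.
\<close>

primrec cone :: "nat \<Rightarrow> nat \<Rightarrow> ((nat \<times> nat) list \<Rightarrow> int) \<Rightarrow> int" where
  "cone k 0 V = V []"
| "cone k (Suc j) V = cone k j (cone_op k j (\<lambda>L. V ((j, 0) # L)))"

section \<open>Linearity and the Stokes formula for iterated cones\<close>

lemma cone_op_diff: "cone_op k j (\<lambda>L. V L - W L) = (\<lambda>L. cone_op k j V L - cone_op k j W L)"
  by (auto simp: cone_op_def fun_eq_iff diff_op_def act_def sum_subtractf)

lemma cone_op_scale: "cone_op k j (\<lambda>L. c * V L) = (\<lambda>L. c * cone_op k j V L)"
  by (auto simp: cone_op_def fun_eq_iff diff_op_def act_def sum_distrib_left algebra_simps)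

lemma cone_diff: "cone k j (\<lambda>L. V L - W L) = cone k j V - cone k j W"
  by (induction j arbitrary: V W) (auto simp: cone_op_diff)

lemma cone_scale: "cone k j (\<lambda>L. c * V L) = c * cone k j V"
  by (induction j arbitrary: V) (auto simp: cone_op_scale)

lemma delta_cone_op: "delta (cone_op k j V) = cone_op k j (delta V)"
  by (auto simp: cone_op_def delta_act delta_diff_op)

lemma cone_op_cone_op:
  assumes "j \<ge> 1" shows "cone_op k j (cone_op k (Suc j) V) X = 0"
  using assms
  by (auto simp: cone_op_def act_diff_op diff_op_norm_op map_rot_funpow)

lemma cone_zero [simp]: "cone k j (\<lambda>L. 0) = 0"
  using cone_scale[of k j 0 "\<lambda>_. 0"] by simp

text \<open>A Stokes formula. The boundary of a cone is its base minus the cone over the boundary of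
  the base, and the base is a cycle because consecutive operators compose to 0.\<close>

lemma cone_delta: "cone k (Suc j) (delta V) = cone k j (cone_op k j V)"
proof (induction j arbitrary: V)
  case 0
  then show ?case by (simp add: cone_op_def)
next
  case (Suc j)
  let ?W = "\<lambda>L. V ((Suc j, 0) # L)"
  have "cone k (Suc (Suc j)) (delta V) =
      cone k (Suc j) (cone_op k (Suc j) V) - cone k (Suc j) (delta (cone_op k (Suc j) ?W))"
    by (subst cone.simps(2)) (simp add: cone_op_diff cone_diff delta_cone_op del: cone.simps)
  also have "cone k (Suc j) (delta (cone_op k (Suc j) ?W)) =
      cone k j (cone_op k j (cone_op k (Suc j) ?W))"
    by (rule Suc)
  also have "\<dots> = 0"
  proof (cases j)
    case 0
    \<comment> \<open>The rotation fixes the empty list, so g - 1 gives 0 there.\<close>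
    then show ?thesis by (simp add: cone_op_def diff_op_def)
  next
    case (Suc i)
    then have "cone_op k j (cone_op k (Suc j) ?W) = (\<lambda>L. 0)"
      using cone_op_cone_op[of j k] by auto
    then show ?thesis by simp
  qed
  finally show ?case by simp
qed

text \<open>The simplices of the join of \<open>n\<close> copies of the cyclic group:
  \<open>(i, a)\<close> is the element \<open>a\<close> of copy \<open>i\<close>, each copy
  contributes at most one vertex, and higher copies come first.\<close>

definition face :: "nat \<Rightarrow> nat \<Rightarrow> (nat \<times> nat) list \<Rightarrow> bool" where
  "face k n X \<longleftrightarrow> sorted_wrt (>) (map fst X) \<and> set X \<subseteq> {..<n} \<times> {..<k}"

lemma set_subseq: "subseq X Y \<Longrightarrow> set X \<subseteq> set Y"
  by (induction X Y rule: list_emb.induct) auto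

lemma face_subseq: "subseq Y X \<Longrightarrow> face k n X \<Longrightarrow> face k n Y"
proof (induction Y X rule: list_emb.induct)
  case (list_emb_Cons2 x y xs ys)
  then show ?case using set_subseq[of xs ys] by (auto simp: face_def)
qed (auto simp: face_def)

lemma face_rot: "face k n X \<Longrightarrow> face k n (map (rot k) X)"
proof -
  have "fst \<circ> rot k = fst" by (auto simp: rot_def fun_eq_iff)
  moreover assume "face k n X"
  ultimately show ?thesis by (auto simp: face_def rot_def split: if_splits)
qed

lemma length_funpow_map [simp]: "length ((map g ^^ a) X) = length X" for g :: "'a \<Rightarrow> 'a"
  by (induction a) auto

lemma face_funpow_rot: "face k n X \<Longrightarrow> face k n ((map (rot k) ^^ a) X)"
  by (induction a) (auto simp: face_rot)

text \<open>The chain behind \<open>cone k j\<close> is supported on the top-dimensional faces of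
  the join of \<open>j\<close> copies: rotations preserve faces, and a new apex has the largest
  index, hence comes first.\<close>

lemma cone_cong:
  assumes "k > 0" "\<And>X. face k j X \<Longrightarrow> length X = j \<Longrightarrow> V X = W X"
  shows "cone k j V = cone k j W"
  using assms(2)
proof (induction j arbitrary: V W)
  case 0
  then show ?case by (simp add: face_def)
next
  case (Suc j)
  have *: "V ((j, 0) # X) = W ((j, 0) # X)" if "face k j X" "length X = j" for X
  proof (rule Suc.prems)
    show "face k (Suc j) ((j, 0) # X)"
      using that assms(1) by (fastforce simp: face_def)
  qed (use that in simp)
  show ?case
    unfolding cone.simps(2)
  proof (rule Suc.IH)
    fix X assume "face k j X" "length X = j"
    then show "cone_op k j (\<lambda>L. V ((j, 0) # L)) X = cone_op k j (\<lambda>L. W ((j, 0) # L)) X"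
      using * face_funpow_rot[of k j X] face_rot[of k j X]
      by (cases "j = 0") (auto simp: cone_op_def diff_op_def act_def)
  qed
qed

subsection \<open>Cochains on cyclic groups\<close>

definition gt :: "nat \<Rightarrow> nat \<Rightarrow> int" where
  "gt a b = (if a > b then 1 else 0)"

text \<open>The coboundary of \<open>gt\<close>. Unlike \<open>gt\<close> it is invariant under the
  cyclic shift.\<close>

definition beta :: "nat \<Rightarrow> nat \<Rightarrow> nat \<Rightarrow> int" where
  "beta a b c = gt b c - gt a c + gt a b"

text \<open>Cup powers of the invariant cocycle \<open>beta\<close>; only lists of odd length matter.\<close>

fun beta_power :: "nat list \<Rightarrow> int" where
  "beta_power (a # b # c # L) = beta a b c * beta_power (c # L)"
| "beta_power _ = 1"

text \<open>
  Cochains on a cyclic group of order \<open>k\<close> realizing a map to the periodic resolution: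
  the coboundary is, alternately, the norm and the difference operator applied to the next one.
\<close>

definition cyc_cochain :: "nat \<Rightarrow> nat list \<Rightarrow> int" where
  "cyc_cochain k L =
    (if L = [] then 1
     else if odd (length L) then (if hd L = k - 1 then beta_power L else 0)
     else gt (L ! 0) (L ! 1) * beta_power (tl L))"

lemma cyc_cochain_simps [simp]:
  "cyc_cochain k [] = 1"
  "even (length L) \<Longrightarrow> cyc_cochain k (a # L) = (if a = k - 1 then beta_power (a # L) else 0)"
  "even (length L) \<Longrightarrow> cyc_cochain k (a # b # L) = gt a b * beta_power (b # L)"
  by (auto simp: cyc_cochain_def)

section \<open>Coboundary relations of the cyclic cochains\<close>

lemma even_list_cases:
  assumes "even (length L)"
  obtains "L = []" | a b M where "L = a # b # M" "even (length M)"
  using assms by (cases L; cases "tl L") auto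

text \<open>Cup powers of a cocycle are cocycles. By induction the deletions behind \<open>c\<close>
  collapse to a multiple of \<open>beta_power (d # N)\<close>; its total coefficient is the
  coboundary of \<open>beta\<close>, which is 0.\<close>

lemma delta_beta_power:
  "even (length L) \<Longrightarrow> L \<noteq> [] \<Longrightarrow> delta beta_power L = 0"
proof (induction L rule: length_induct)
  case (1 L)
  from 1(2) show ?case
  proof (cases L rule: even_list_cases)
    case 1
    then show ?thesis using \<open>L \<noteq> []\<close> by simp
  next
    case (2 a b M)
    from \<open>even (length M)\<close> show ?thesis
    proof (cases M rule: even_list_cases)
      case 1
      then show ?thesis using 2 by simp
    next
      case M: (2 c d N)
      have N: "delta (\<lambda>L. beta_power (c # d # L)) N = beta_power (c # N) - beta_power (d # N)"
        using 1(1)[rule_format, of "c # d # N"] 2 M by simp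
      have "delta beta_power L =
          (beta b c d - beta a c d + beta a b d - beta a b c) * beta_power (d # N)"
        using 2 M by (simp add: delta_scale N[simplified] algebra_simps)
      also have "\<dots> = 0" by (simp add: beta_def)
      finally show ?thesis .
    qed
  qed
qed

lemma delta_beta_power_Cons2:
  assumes "even (length L)"
  shows "delta (\<lambda>L. beta_power (a # b # L)) L = beta_power (a # L) - beta_power (b # L)"
  using delta_beta_power[of "a # b # L"] assms by simp

lemma subseq_Suc_even: "Suc (length Y) = length X \<Longrightarrow> even (length X) \<Longrightarrow> odd (length Y)"
  by (metis even_Suc)

text \<open>On even lists the cochain is the cup product of \<open>gt\<close> with a power of
  \<open>beta\<close>, and the coboundary turns \<open>gt\<close> into \<open>beta\<close>. On a
  singleton both sides are 1.\<close>

lemma delta_cyc_cochain_odd: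
  assumes "odd (length L)"
  shows "delta (cyc_cochain k) L = beta_power L"
proof -
  obtain a M where M: "L = a # M" "even (length M)"
    using assms by (cases L) auto
  from M(2) show ?thesis
  proof (cases M rule: even_list_cases)
    case 1
    then show ?thesis using M by simp
  next
    case (2 b c N)
    have "delta (\<lambda>L. cyc_cochain k (a # b # c # L)) N =
        delta (\<lambda>L. gt a b * beta_power (b # c # L)) N"
      by (rule delta_cong) (use 2 in \<open>auto simp: subseq_Suc_even\<close>)
    also have "\<dots> = gt a b * (beta_power (b # N) - beta_power (c # N))"
      using 2 by (simp add: delta_scale delta_beta_power_Cons2 del: beta_power.simps)
    finally show ?thesis
      using M 2 by (simp add: beta_def algebra_simps)
  qed
qed

text \<open>Only the wraparound from \<open>k - 1\<close> to 0 changes an order relation, so the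
  change of \<open>gt\<close> is the coboundary of the indicator of \<open>k - 1\<close>.\<close>

lemma gt_shift:
  assumes "a < k" "b < k"
  shows "gt (Suc a mod k) (Suc b mod k) - gt a b =
    (if b = k - 1 then 1 else 0) - (if a = k - 1 then 1 else 0)"
proof -
  have "Suc c mod k = (if c = k - 1 then 0 else Suc c)" if "c < k" for c
    using that by auto
  then show ?thesis using assms by (auto simp: gt_def)
qed

lemma beta_shift:
  assumes "a < k" "b < k" "c < k"
  shows "beta (Suc a mod k) (Suc b mod k) (Suc c mod k) = beta a b c"
  using gt_shift[of a k b] gt_shift[of b k c] gt_shift[of a k c] assms
  by (simp add: beta_def)

lemma beta_power_shift:
  "set L \<subseteq> {..<k} \<Longrightarrow> beta_power (map (\<lambda>a. Suc a mod k) L) = beta_power L"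
  by (induction L rule: beta_power.induct) (auto simp: beta_shift)

text \<open>On odd lists the cochain is the indicator of \<open>k - 1\<close> times a power of
  \<open>beta\<close>. The coboundary acts on the indicator alone, and \<open>gt_shift\<close> reads
  the result as a shift difference of \<open>gt\<close>.\<close>

lemma delta_cyc_cochain_even:
  assumes "even (length L)" "L \<noteq> []" "set L \<subseteq> {..<k}"
  shows "delta (cyc_cochain k) L = diff_op (map (\<lambda>a. Suc a mod k)) (cyc_cochain k) L"
proof -
  obtain a b N where L: "L = a # b # N" "even (length N)"
    using assms by (metis even_list_cases)
  have "delta (\<lambda>L. cyc_cochain k (a # b # L)) N =
      delta (\<lambda>L. (if a = k - 1 then 1 else 0) * beta_power (a # b # L)) N"
    by (rule delta_cong) (use L in \<open>auto simp: subseq_Suc_even\<close>)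
  also have "\<dots> = (if a = k - 1 then 1 else 0) * (beta_power (a # N) - beta_power (b # N))"
    using L by (simp add: delta_scale delta_beta_power_Cons2)
  finally have E: "delta (\<lambda>L. cyc_cochain k (a # b # L)) N =
      (if a = k - 1 then 1 else 0) * (beta_power (a # N) - beta_power (b # N))" .
  have "delta (cyc_cochain k) L = (if b = k - 1 then 1 else 0) * beta_power (b # N) -
      ((if a = k - 1 then 1 else 0) * beta_power (a # N) -
        delta (\<lambda>L. cyc_cochain k (a # b # L)) N)"
    using L by simp
  then have "delta (cyc_cochain k) L =
      ((if b = k - 1 then 1 else 0) - (if a = k - 1 then 1 else 0)) * beta_power (b # N)"
    unfolding E by (simp only: algebra_simps)
  also have "\<dots> = (gt (Suc a mod k) (Suc b mod k) - gt a b) * beta_power (b # N)"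
    using L assms by (subst gt_shift) auto
  also have "\<dots> = diff_op (map (\<lambda>a. Suc a mod k)) (cyc_cochain k) L"
    using L assms beta_power_shift[of "b # N" k] by (simp add: diff_op_def algebra_simps)
  finally show ?thesis .
qed

lemma shift_funpow: "x < k \<Longrightarrow> ((\<lambda>a. Suc a mod k) ^^ a) x = (x + a) mod k"
  by (induction a) (auto simp: mod_Suc_eq)

lemma beta_power_funpow_shift:
  assumes "set L \<subseteq> {..<k}"
  shows "beta_power ((map (\<lambda>a. Suc a mod k) ^^ a) L) = beta_power L
    \<and> set ((map (\<lambda>a. Suc a mod k) ^^ a) L) \<subseteq> {..<k}"
  using assms by (induction a) (auto simp: beta_power_shift image_subset_iff)

text \<open>Exactly one shift brings the head to \<open>k - 1\<close>, and \<open>beta_power\<close>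
  is the same for all shifts.\<close>

lemma norm_op_cyc_cochain:
  assumes "odd (length L)" "set L \<subseteq> {..<k}"
  shows "norm_op k (map (\<lambda>a. Suc a mod k)) (cyc_cochain k) L = beta_power L"
proof -
  obtain x M where M: "L = x # M" "even (length M)" "x < k"
    using assms by (cases L) auto
  let ?s = "map (\<lambda>a. Suc a mod k)"
  have "cyc_cochain k ((?s ^^ a) L) = (if a = k - 1 - x then beta_power L else 0)" if "a < k" for a
  proof -
    have "hd ((?s ^^ a) L) = (x + a) mod k"
      using M by (simp add: map_funpow shift_funpow)
    moreover have "(x + a) mod k = k - 1 \<longleftrightarrow> a = k - 1 - x"
    proof (cases "x + a < k")
      case False
      then have "(x + a) mod k = x + a - k"
        using that M by (simp add: mod_if)
      then show ?thesis using that M False by auto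
    qed (use M in auto)
    moreover have "(?s ^^ a) L \<noteq> []" "odd (length ((?s ^^ a) L))"
      using M by (auto simp: map_funpow)
    ultimately show ?thesis
      using beta_power_funpow_shift[OF assms(2), of a]
      by (cases "a = k - 1 - x") (auto simp: cyc_cochain_def)
  qed
  then have "norm_op k ?s (cyc_cochain k) L = (\<Sum>a<k. if a = k - 1 - x then beta_power L else 0)"
    by (simp add: act_def)
  also have "\<dots> = beta_power L"
    using M by (subst sum.delta) auto
  finally show ?thesis .
qed

text \<open>From \<open>gt a a = 0\<close> it follows that \<open>beta a a c\<close> and
  \<open>beta a b b\<close> vanish, so equal neighbors make some factor 0: the cochains are
  normalized.\<close>

lemma beta_power_degenerate:
  "odd (length L) \<Longrightarrow> \<not> distinct_adj L \<Longrightarrow> beta_power L = 0"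
  by (induction L rule: beta_power.induct) (auto simp: beta_def gt_def)

lemma cyc_cochain_degenerate:
  assumes "\<not> distinct_adj L"
  shows "cyc_cochain k L = 0"
proof (cases "even (length L)")
  case True
  then show ?thesis
    using assms
    by (cases L rule: even_list_cases) (auto simp: beta_power_degenerate gt_def)
qed (use assms in \<open>auto simp: cyc_cochain_def beta_power_degenerate\<close>)

subsection \<open>A Tucker lemma for cyclic groups\<close>

text \<open>Neighbors have different signs, hence different levels, so the level drops by at least 1
  at every step of the list.\<close>

lemma length_le_level:
  assumes "sorted_wrt (\<lambda>A B. h B \<le> h A \<and> (h B = h A \<longrightarrow> \<sigma> B = \<sigma> A)) L"
    "distinct_adj (map \<sigma> L)" "\<And>A. A \<in> set L \<Longrightarrow> (1 :: nat) \<le> h A" "L \<noteq> []"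
  shows "length L \<le> h (hd L)"
  using assms
proof (induction L rule: induct_list012)
  case (3 A B L)
  have "length (B # L) \<le> h B" using 3 by simp
  moreover have "h B < h A" using 3 by (auto simp: order_less_le)
  ultimately show ?case by simp
qed auto

text \<open>The pair \<open>(h, \<sigma>)\<close> maps the subdivided join of \<open>n\<close>
  copies to a join of \<open>m\<close> copies. The signs alone define the cochains; the levels enter
  only to make the top cochain vanish when \<open>m < n\<close>.\<close>

theorem cyclic_tucker:
  fixes \<sigma> h :: "(nat \<times> nat) list \<Rightarrow> nat"
  assumes k: "k \<ge> 2"
    and sign: "\<And>X. face k n X \<Longrightarrow> X \<noteq> [] \<Longrightarrow> \<sigma> X < k \<and> \<sigma> (map (rot k) X) = Suc (\<sigma> X) mod k"
    and level: "\<And>X. face k n X \<Longrightarrow> X \<noteq> [] \<Longrightarrow> 1 \<le> h X \<and> h X \<le> m"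
    and mono: "\<And>X Y. face k n Y \<Longrightarrow> X \<noteq> [] \<Longrightarrow> subseq X Y \<Longrightarrow>
      h X \<le> h Y \<and> (h X = h Y \<longrightarrow> \<sigma> X = \<sigma> Y)"
  shows "n \<le> m"
proof (rule ccontr)
  assume "\<not> n \<le> m"
  define s where "s = map (rot k)"
  define \<phi> where "\<phi> = (\<lambda>L. cyc_cochain k (map \<sigma> L))"
  define V where "V = (\<lambda>j. sd j \<phi>)"
  \<comment> \<open>The numbers whose divisibility by \<open>k\<close> descends from degree
    \<open>n\<close> to degree 1.\<close>
  define I where "I = (\<lambda>j. cone k j (norm_op k s (V j)))"
  have flag_face: "face k n Y \<and> Y \<noteq> [] \<and> \<sigma> Y < k" if "face k n X" "flag X L" "Y \<in> set L" for X L Y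
    using that sign face_subseq by (auto simp: flag_def)
  have sigma_shift: "map \<sigma> (map s L) = map (\<lambda>a. Suc a mod k) (map \<sigma> L)"
    if "\<And>Y. Y \<in> set L \<Longrightarrow> face k n Y \<and> Y \<noteq> []" for L
    using that sign by (auto simp: s_def)
  have sigma_funpow: "map \<sigma> ((map s ^^ a) L) = (map (\<lambda>a. Suc a mod k) ^^ a) (map \<sigma> L)"
    if "\<And>Y. Y \<in> set L \<Longrightarrow> face k n Y \<and> Y \<noteq> []" for L a
  proof (induction a)
    case (Suc a)
    have "face k n Y \<and> Y \<noteq> []" if Y: "Y \<in> set ((map s ^^ a) L)" for Y
    proof -
      obtain Z where "Z \<in> set L" "Y = (s ^^ a) Z" using Y by (auto simp: map_funpow)
      then show ?thesis
        using \<open>\<And>Y. Y \<in> set L \<Longrightarrow> face k n Y \<and> Y \<noteq> []\<close>[of Z] face_funpow_rot[of k n Z a]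
        by (auto simp: s_def map_funpow)
    qed
    then show ?case
      using sigma_shift[of "(map s ^^ a) L"] Suc by (simp del: map_map)
  qed simp
  \<comment> \<open>The relations of the periodic resolution, pulled back to faces: the norm for
    even \<open>j\<close>, and below g - 1 for odd \<open>j\<close>.\<close>
  have delta_odd: "delta (V j) X = norm_op k s (V (Suc j)) X"
    if "even j" "face k n X" "length X = Suc j" for j X
  proof -
    have "sd (Suc j) (delta \<phi>) X = sd (Suc j) (norm_op k (map s) \<phi>) X"
    proof (rule sd_cong)
      fix L assume L: "length L = Suc j" "flag X L"
      have "set (map \<sigma> L) \<subseteq> {..<k}" using flag_face[OF that(2) L(2)] by auto
      moreover have "odd (length (map \<sigma> L))" using L that by simp
      ultimately have "delta (cyc_cochain k) (map \<sigma> L) =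
          norm_op k (map (\<lambda>a. Suc a mod k)) (cyc_cochain k) (map \<sigma> L)"
        using delta_cyc_cochain_odd norm_op_cyc_cochain by metis
      also have "\<dots> = norm_op k (map s) \<phi> L"
        using sigma_funpow[of L] flag_face[OF that(2) L(2)] by (simp add: act_def \<phi>_def)
      finally show "delta \<phi> L = norm_op k (map s) \<phi> L"
        by (simp add: \<phi>_def delta_map)
    qed (use that in simp)
    then show ?thesis by (simp only: V_def sd_delta s_def sd_act)
  qed
  have delta_even: "delta (V j) X = diff_op s (V (Suc j)) X"
    if "odd j" "face k n X" "length X = Suc j" for j X
  proof -
    have "sd (Suc j) (delta \<phi>) X = sd (Suc j) (diff_op (map s) \<phi>) X"
    proof (rule sd_cong)
      fix L assume L: "length L = Suc j" "flag X L"
      have "set (map \<sigma> L) \<subseteq> {..<k}" using flag_face[OF that(2) L(2)] by auto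
      moreover have "even (length (map \<sigma> L))" "map \<sigma> L \<noteq> []" using L that by auto
      ultimately have "delta (cyc_cochain k) (map \<sigma> L) =
          diff_op (map (\<lambda>a. Suc a mod k)) (cyc_cochain k) (map \<sigma> L)"
        by (intro delta_cyc_cochain_even)
      also have "\<dots> = diff_op (map s) \<phi> L"
        using sigma_shift[of L] flag_face[OF that(2) L(2)]
        by (simp add: diff_op_def \<phi>_def del: map_map)
      finally show "delta \<phi> L = diff_op (map s) \<phi> L"
        by (simp add: \<phi>_def delta_map)
    qed (use that in simp)
    then show ?thesis by (simp only: V_def sd_delta s_def sd_diff_op)
  qed
  have face_mono: "face k n X" if "face k j X" "j \<le> n" for X j
    using that by (fastforce simp: face_def)
  have I_1: "I 1 = 1"
  proof -
    have "I 1 = cone k (Suc 0) (delta (V 0))"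
      unfolding I_def One_nat_def
    proof (rule cone_cong)
      fix X assume "face k (Suc 0) X" "length X = Suc 0"
      then show "norm_op k s (V (Suc 0)) X = delta (V 0) X"
        using delta_odd[of 0 X] face_mono \<open>\<not> n \<le> m\<close> by simp
    qed (use k in simp)
    also have "\<dots> = 1"
      by (subst cone_delta) (simp add: cone_op_def V_def \<phi>_def)
    finally show ?thesis .
  qed
  have I_Suc: "int k dvd I j" if "int k dvd I (Suc j)" "1 \<le> j" "j < n" for j
  proof (cases "even j")
    case True
    \<comment> \<open>For even \<open>j\<close> the Stokes formula gives equality of
      \<open>I (Suc j)\<close> and \<open>I j\<close>.\<close>
    have "I (Suc j) = cone k (Suc j) (delta (V j))"
      unfolding I_def
      by (rule cone_cong) (use k True \<open>j < n\<close> delta_odd face_mono in \<open>auto\<close>)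
    also have "\<dots> = I j"
      using True \<open>1 \<le> j\<close> by (subst cone_delta) (simp add: cone_op_def I_def s_def)
    finally show ?thesis using that by simp
  next
    case False
    \<comment> \<open>For odd \<open>j\<close>, composing g - 1 with \<open>?D\<close> gives k minus
      the norm, so the Stokes formula for \<open>?D (V j)\<close> makes \<open>I j\<close> and
      \<open>I (Suc j)\<close> congruent modulo \<open>k\<close>.\<close>
    let ?D = "act k int s"
    have per: "(s ^^ k) X = X" for X by (simp add: s_def map_rot_funpow)
    have D: "diff_op s (?D W) = (\<lambda>X. int k * W X - norm_op k s W X)" for W
      by (rule ext) (rule diff_op_act_linear[OF per])
    have eq: "delta (?D (V j)) X = int k * V (Suc j) X - norm_op k s (V (Suc j)) X"
      if X: "face k (Suc j) X" "length X = Suc j" for X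
    proof -
      have "delta (?D (V j)) X = ?D (delta (V j)) X"
        by (simp add: s_def delta_act)
      also have "\<dots> = ?D (diff_op s (V (Suc j))) X"
      proof -
        have "delta (V j) ((s ^^ a) X) = diff_op s (V (Suc j)) ((s ^^ a) X)" for a
          using X False \<open>j < n\<close> face_funpow_rot[of k "Suc j" X a]
          by (intro delta_even face_mono[of "Suc j"]) (auto simp: s_def)
        then show ?thesis by (simp add: act_def)
      qed
      also have "\<dots> = int k * V (Suc j) X - norm_op k s (V (Suc j)) X"
        by (simp add: act_diff_op D)
      finally show ?thesis .
    qed
    have "int k * cone k (Suc j) (V (Suc j)) - I (Suc j) = cone k (Suc j) (delta (?D (V j)))"
      unfolding I_def cone_scale[symmetric] cone_diff[symmetric]
      by (rule cone_cong) (use k eq in auto)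
    also have "\<dots> = cone k j (diff_op s (?D (V j)))"
      using False \<open>1 \<le> j\<close> by (subst cone_delta) (simp add: cone_op_def s_def)
    also have "\<dots> = int k * cone k j (V j) - I j"
      by (simp add: D cone_diff cone_scale I_def)
    finally have "I j = I (Suc j) + int k * (cone k j (V j) - cone k (Suc j) (V (Suc j)))"
      by (simp add: algebra_simps)
    then show ?thesis using that by simp
  qed
  \<comment> \<open>A flag of \<open>n\<close> faces without equal neighboring signs would need
    \<open>n\<close> levels, but there are only \<open>m < n\<close>; on all other flags the
    normalized cochain is 0.\<close>
  have "V n X = 0" if X: "face k n X" "length X = n" for X
  proof -
    have "V n X = sd n (\<lambda>L. 0 * \<phi> L) X"
      unfolding V_def
    proof (rule sd_cong)
      fix L assume L: "length L = n" "flag X L"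
      have "\<not> distinct_adj (map \<sigma> L)"
      proof
        assume "distinct_adj (map \<sigma> L)"
        moreover have "sorted_wrt (\<lambda>A B. h B \<le> h A \<and> (h B = h A \<longrightarrow> \<sigma> B = \<sigma> A)) L"
        proof (rule sorted_wrt_mono_rel)
          show "sorted_wrt (\<lambda>A B. subseq B A) L" using L(2) by (simp add: flag_def)
          fix A B assume "A \<in> set L" "B \<in> set L" "subseq B A"
          then show "h B \<le> h A \<and> (h B = h A \<longrightarrow> \<sigma> B = \<sigma> A)"
            using mono[of A B] flag_face[OF X(1) L(2)] by blast
        qed
        moreover have "L \<noteq> []" using L \<open>\<not> n \<le> m\<close> by auto
        ultimately have "length L \<le> h (hd L)"
          using flag_face[OF X(1) L(2)] level by (intro length_le_level[of h \<sigma>]) auto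
        also have "\<dots> \<le> m"
          using flag_face[OF X(1) L(2), of "hd L"] level \<open>L \<noteq> []\<close> by auto
        finally show False using L \<open>\<not> n \<le> m\<close> by simp
      qed
      then show "\<phi> L = 0 * \<phi> L" by (simp add: \<phi>_def cyc_cochain_degenerate)
    qed (use X in simp)
    then show ?thesis using sd_scale[of n 0 \<phi>] by simp
  qed
  then have "I n = cone k n (\<lambda>X. 0)"
    unfolding I_def
    by (intro cone_cong) (use k face_funpow_rot in \<open>auto simp: act_def s_def intro!: sum.neutral\<close>)
  then have "int k dvd I n" by simp
  moreover have "int k dvd I j \<Longrightarrow> int k dvd I 1" if "1 \<le> j" "j \<le> n" for j
    using that
  proof (induction j rule: nat_induct_at_least)
    case (Suc j)
    then show ?case using I_Suc[of j] by simp
  qed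
  moreover have "1 \<le> n" using \<open>\<not> n \<le> m\<close> by simp
  ultimately have "int k dvd I 1" by blast
  then show False using I_1 k by simp
qed

subsection \<open>Monochromatic matchings in complete uniform hypergraphs\<close>

definition rot_snd :: "nat \<Rightarrow> ('c \<times> nat) set \<Rightarrow> ('c \<times> nat) set" where
  "rot_snd p S = (\<lambda>(c, a). (c, Suc a mod p)) ` S"

lemma inj_on_Suc_mod: "inj_on (\<lambda>a. Suc a mod p) {..<p}"
proof (rule inj_onI)
  fix a b assume "a \<in> {..<p}" "b \<in> {..<p}" "Suc a mod p = Suc b mod p"
  then show "a = b" by (auto simp: mod_Suc split: if_splits)
qed

text \<open>
  This is where the primality is needed: translating a set of \<open>q\<close> residues increases the
  sum of its elements by \<open>q\<close>, so that sum divided by \<open>q\<close> is equivariant.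
\<close>

lemma equivariant_choice:
  assumes "prime p"
  shows "\<exists>\<tau> :: (nat \<times> nat) set \<Rightarrow> nat. \<forall>S.
    S \<noteq> {} \<and> snd ` S \<subseteq> {..<p} \<and> (\<forall>c. \<not> {c} \<times> {..<p} \<subseteq> S) \<longrightarrow>
      \<tau> S < p \<and> \<tau> (rot_snd p S) = Suc (\<tau> S) mod p"
proof -
  \<comment> \<open>The least color that occurs is unchanged by rotation, so it selects one set of
    residues equivariantly.\<close>
  define c0 where "c0 = (\<lambda>S :: (nat \<times> nat) set. LEAST c. c \<in> fst ` S)"
  define B where "B = (\<lambda>S :: (nat \<times> nat) set. {a. (c0 S, a) \<in> S})"
  define \<tau> where "\<tau> = (\<lambda>S. (SOME z. [card (B S) * z = 1] (mod p)) * \<Sum>(B S) mod p)"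
  have "\<tau> S < p \<and> \<tau> (rot_snd p S) = Suc (\<tau> S) mod p"
    if S: "S \<noteq> {}" "snd ` S \<subseteq> {..<p}" "\<And>c. \<not> {c} \<times> {..<p} \<subseteq> S" for S
  proof
    have "p > 0" using assms prime_gt_0_nat by blast
    then show "\<tau> S < p" by (simp add: \<tau>_def)
    have "fst ` rot_snd p S = fst ` S"
      by (force simp: rot_snd_def)
    then have c0: "c0 (rot_snd p S) = c0 S" by (simp add: c0_def)
    have rot: "B (rot_snd p S) = (\<lambda>a. Suc a mod p) ` B S"
      unfolding B_def c0 by (auto simp: rot_snd_def)
    have Bp: "B S \<subseteq> {..<p}" using S(2) by (force simp: B_def)
    then have fin: "finite (B S)" using finite_subset by blast
    have "c0 S \<in> fst ` S"
      unfolding c0_def by (rule LeastI_ex) (use S(1) in auto)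
    then have "B S \<noteq> {}" by (force simp: B_def)
    moreover have "B S \<noteq> {..<p}" using S(3)[of "c0 S"] by (auto simp: B_def)
    ultimately have "0 < card (B S)" "card (B S) < p"
      using fin Bp psubset_card_mono[of "{..<p}" "B S"] by (auto simp: card_gt_0_iff)
    then have "coprime (card (B S)) p"
      using assms by (metis coprime_commute dvd_imp_le not_le prime_imp_coprime)
    then have ex: "\<exists>z. [card (B S) * z = 1] (mod p)"
      using cong_solve_coprime_nat by auto
    define z where "z = (SOME z. [card (B S) * z = 1] (mod p))"
    have z: "[card (B S) * z = 1] (mod p)"
      unfolding z_def by (rule someI_ex) (rule ex)
    have inj: "inj_on (\<lambda>a. Suc a mod p) (B S)"
      using inj_on_Suc_mod Bp by (rule inj_on_subset)
    then have "card (B (rot_snd p S)) = card (B S)"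
      by (simp add: rot card_image)
    then have "\<tau> (rot_snd p S) = z * \<Sum>(B (rot_snd p S)) mod p"
      by (simp add: \<tau>_def z_def)
    also have "\<Sum>(B (rot_snd p S)) = (\<Sum>a\<in>B S. Suc a mod p)"
      by (simp add: rot sum.reindex[OF inj])
    also have "[z * (\<Sum>a\<in>B S. Suc a mod p) = z * (\<Sum>a\<in>B S. Suc a)] (mod p)"
      by (intro cong_mult cong_refl cong_sum) (auto simp: cong_def)
    then have "z * (\<Sum>a\<in>B S. Suc a mod p) mod p = z * (\<Sum>a\<in>B S. Suc a) mod p"
      by (simp add: cong_def)
    also have "z * (\<Sum>a\<in>B S. Suc a) = z * \<Sum>(B S) + card (B S) * z"
      by (simp add: sum_Suc algebra_simps)
    also have "[\<dots> = z * \<Sum>(B S) + 1] (mod p)"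
      by (intro cong_add cong_refl z)
    then have "(z * \<Sum>(B S) + card (B S) * z) mod p = (z * \<Sum>(B S) + 1) mod p"
      by (simp add: cong_def)
    also have "\<dots> = Suc (\<tau> S) mod p"
      by (simp add: \<tau>_def z_def mod_Suc_eq)
    finally show "\<tau> (rot_snd p S) = Suc (\<tau> S) mod p" .
  qed
  then show ?thesis by blast
qed

definition mono_matching :: "'a set \<Rightarrow> nat \<Rightarrow> nat \<Rightarrow> ('a set \<Rightarrow> nat) \<Rightarrow> nat \<Rightarrow> bool" where
  "mono_matching A r k f c \<longleftrightarrow> (\<exists>M \<subseteq> nsets A r. card M = k \<and> disjoint M \<and> (\<forall>F\<in>M. f F = c))"

lemma mono_matching_le:
  assumes "mono_matching A r k f c" "l \<le> k"
  shows "mono_matching A r l f c"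
proof -
  obtain M where M: "M \<subseteq> nsets A r" "card M = k" "disjoint M" "\<forall>F\<in>M. f F = c"
    using assms(1) by (auto simp: mono_matching_def)
  obtain N where "N \<subseteq> M" "card N = l"
    using obtain_subset_with_card_n[of l M] M assms(2) by auto
  moreover from this have "disjoint N" using M(3) unfolding disjoint_def by blast
  ultimately show ?thesis
    using M unfolding mono_matching_def by (intro exI[of _ N]) auto
qed

lemma mono_matching_image:
  assumes "mono_matching A r k (\<lambda>F. f (b ` F)) c" "inj_on b A"
  shows "mono_matching (b ` A) r k f c"
proof -
  obtain M where M: "M \<subseteq> nsets A r" "card M = k" "disjoint M" "\<forall>F\<in>M. f (b ` F) = c"
    using assms(1) by (auto simp: mono_matching_def)
  have sub: "\<Union>M \<subseteq> A" using M(1) by (auto simp: nsets_def)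
  have "inj_on ((`) b) M"
    using sub assms(2) by (intro inj_onI) (metis Sup_le_iff inj_on_image_eq_iff)
  moreover have "disjoint ((`) b ` M)"
    using M(3) inj_on_subset[OF assms(2) sub] by (intro disjoint_image)
  moreover have "(`) b ` M \<subseteq> nsets (b ` A) r"
    using M(1) assms(2) by (auto simp: nsets_def card_image inj_on_subset subset_iff)
  ultimately show ?thesis
    using M unfolding mono_matching_def
    by (intro exI[of _ "(`) b ` M"]) (auto simp: card_image)
qed

lemma distinct_positions: "face k n X \<Longrightarrow> distinct (map fst X)"
proof -
  have "sorted_wrt (>) xs \<Longrightarrow> distinct xs" for xs :: "nat list"
    by (induction xs) auto
  then show "face k n X \<Longrightarrow> distinct (map fst X)" by (simp add: face_def)
qed

text \<open>A face of the join of \<open>n\<close> copies encodes \<open>p\<close> disjoint sets of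
  points, its parts. Without a monochromatic matching, \<open>cyclic_tucker\<close> would bound
  \<open>n\<close> by a number of levels that is one too small.\<close>

lemma kneser_hypergraph_prime_lessThan:
  fixes f :: "nat set \<Rightarrow> nat"
  assumes p: "prime p" and "r > 0" "t > 0" and n: "n = r * p + (t - 1) * (p - 1)"
    and f: "\<And>F. F \<in> nsets {..<n} r \<Longrightarrow> f F < t"
  shows "\<exists>c<t. mono_matching {..<n} r p f c"
proof (rule ccontr)
  assume no_matching: "\<not> ?thesis"
  have "p \<ge> 2" using p prime_ge_2_nat by blast
  define part :: "(nat \<times> nat) list \<Rightarrow> nat \<Rightarrow> nat set" where "part = (\<lambda>X a. {i. (i, a) \<in> set X})"
  define S where "S = (\<lambda>X. {(c, a). c < t \<and> a < p \<and> (\<exists>F \<in> nsets (part X a) r. f F = c)})"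
  obtain \<tau> :: "(nat \<times> nat) set \<Rightarrow> nat" where \<tau>:
    "\<And>S. S \<noteq> {} \<Longrightarrow> snd ` S \<subseteq> {..<p} \<Longrightarrow> (\<And>c. \<not> {c} \<times> {..<p} \<subseteq> S) \<Longrightarrow>
      \<tau> S < p \<and> \<tau> (rot_snd p S) = Suc (\<tau> S) mod p"
    using equivariant_choice[OF p] by metis
  \<comment> \<open>While no part contains an \<open>r\<close>-set, the level is the number of
    points used, at most \<open>p * (r - 1)\<close>. Afterwards levels start above that bound and
    count the occurring pairs of color and part.\<close>
  define \<sigma> where "\<sigma> = (\<lambda>X. if S X = {} then snd (hd X) else \<tau> (S X))"
  define h where "h = (\<lambda>X. if S X = {} then length X else p * (r - 1) + card (S X))"
  have S_sub: "S X \<subseteq> {..<t} \<times> {..<p}" for X by (auto simp: S_def)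
  have fin_S: "finite (S X)" for X using S_sub finite_subset by blast
  have part_less: "part X a \<subseteq> {..<n}" if "face p n X" for X a
    using that by (auto simp: face_def part_def)
  \<comment> \<open>A color occurring in every part would give \<open>p\<close> disjoint sets of
    that color, so each color misses a part, as \<tau> requires.\<close>
  have not_full: "\<not> {c} \<times> {..<p} \<subseteq> S X" if X: "face p n X" for X c
  proof
    assume full: "{c} \<times> {..<p} \<subseteq> S X"
    then have "\<forall>a\<in>{..<p}. \<exists>F \<in> nsets (part X a) r. f F = c" by (auto simp: S_def)
    then obtain F where F: "\<And>a. a < p \<Longrightarrow> F a \<in> nsets (part X a) r \<and> f (F a) = c"
      by (metis lessThan_iff)
    have disj: "F a \<inter> F b = {}" if "a < p" "b < p" "a \<noteq> b" for a b
      using F[OF that(1)] F[OF that(2)] that(3) eq_key_imp_eq_value[OF distinct_positions[OF X]]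
      by (fastforce simp: nsets_def part_def)
    have ne: "F a \<noteq> {}" if "a < p" for a using F[OF that] \<open>r > 0\<close> by (auto simp: nsets_def)
    have "inj_on F {..<p}"
      using disj ne by (intro inj_onI) (metis Int_absorb lessThan_iff)
    then have "card (F ` {..<p}) = p" by (simp add: card_image)
    moreover have "disjoint (F ` {..<p})" using disj by (auto simp: disjoint_def)
    moreover have "F ` {..<p} \<subseteq> nsets {..<n} r"
      using F nsets_mono[OF part_less[OF X]] by blast
    ultimately have "mono_matching {..<n} r p f c"
      using F unfolding mono_matching_def by (intro exI[of _ "F ` {..<p}"]) auto
    moreover have "(c, 0) \<in> S X" using full \<open>p \<ge> 2\<close> by auto
    then have "c < t" by (simp add: S_def)
    ultimately show False using no_matching by blast
  qed
  have length_le: "length X \<le> p * (r - 1)" if X: "face p n X" "S X = {}" for X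
  proof -
    have fin: "finite (part X a)" for a
      using part_less[OF X(1)] finite_subset by blast
    have "card (part X a) \<le> r - 1" if "a < p" for a
    proof (rule ccontr)
      assume "\<not> card (part X a) \<le> r - 1"
      then have "r \<le> card (part X a)" by simp
      then obtain F where F: "F \<subseteq> part X a" "card F = r"
        by (rule obtain_subset_with_card_n)
      then have "F \<in> nsets (part X a) r" "F \<in> nsets {..<n} r"
        using finite_subset[OF F(1) fin] part_less[OF X(1), of a] by (auto simp: nsets_def)
      then have "(f F, a) \<in> S X" using f that by (auto simp: S_def)
      then show False using X by simp
    qed
    then have "(\<Sum>a<p. card (part X a)) \<le> p * (r - 1)"
      using sum_bounded_above[of "{..<p}" "\<lambda>a. card (part X a)" "r - 1"] by simp
    moreover have "(i, a) \<in> set X \<longleftrightarrow> (i, a) \<in> prod.swap ` (SIGMA a:{..<p}. part X a)" for i a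
      using X(1) by (auto simp: part_def face_def)
    then have "set X = prod.swap ` (SIGMA a:{..<p}. part X a)" by (simp add: set_eq_iff)
    then have "card (set X) = (\<Sum>a<p. card (part X a))"
      using fin by (simp add: card_image)
    moreover have "card (set X) = length X"
      using distinct_positions[OF X(1)] distinct_card distinct_map by blast
    ultimately show ?thesis by simp
  qed
  have S_rot: "S (map (rot p) X) = rot_snd p (S X)" if X: "face p n X" for X
  proof -
    have part_rot: "part (map (rot p) X) (Suc a mod p) = part X a" if "a < p" for a
    proof -
      have "(i, Suc a mod p) \<in> rot p ` set X \<longleftrightarrow> (i, a) \<in> set X" for i
      proof
        assume "(i, Suc a mod p) \<in> rot p ` set X"
        then obtain y where y: "y \<in> set X" "(i, Suc a mod p) = rot p y" by blast
        moreover from y(2) obtain b where "y = (i, b)" by (cases y) (simp add: rot_def)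
        ultimately have b: "(i, b) \<in> set X" "(i, Suc a mod p) = rot p (i, b)" by auto
        have "b < p" using b(1) X by (auto simp: face_def)
        then have "Suc a mod p = Suc b mod p" using b(2) by (simp add: rot_def)
        then have "a = b"
          using inj_on_Suc_mod[of p] that \<open>b < p\<close> unfolding inj_on_def by (metis lessThan_iff)
        then show "(i, a) \<in> set X" using b by simp
      next
        assume "(i, a) \<in> set X"
        then show "(i, Suc a mod p) \<in> rot p ` set X"
          using that by (intro image_eqI[of _ _ "(i, a)"]) (auto simp: rot_def)
      qed
      then show ?thesis by (simp add: part_def)
    qed
    have surj: "\<exists>a'<p. a = Suc a' mod p" if "a < p" for a
      using that \<open>p \<ge> 2\<close>
      by (intro exI[of _ "if a = 0 then p - 1 else a - 1"]) auto
    show ?thesis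
    proof (rule set_eqI)
      fix y :: "nat \<times> nat"
      obtain c a where y: "y = (c, a)" by fastforce
      show "y \<in> S (map (rot p) X) \<longleftrightarrow> y \<in> rot_snd p (S X)"
      proof
        assume L: "y \<in> S (map (rot p) X)"
        then obtain a' where "a' < p" "a = Suc a' mod p" using surj y by (auto simp: S_def)
        then show "y \<in> rot_snd p (S X)"
          using L y part_rot by (auto simp: S_def rot_snd_def intro!: image_eqI[of _ _ "(c, a')"])
      next
        assume "y \<in> rot_snd p (S X)"
        then show "y \<in> S (map (rot p) X)"
          using part_rot \<open>p \<ge> 2\<close> y by (auto simp: S_def rot_snd_def)
      qed
    qed
  qed
  have "n \<le> p * (r - 1) + t * (p - 1)"
  proof (rule cyclic_tucker[OF \<open>p \<ge> 2\<close>, of n \<sigma> h])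
    fix X assume X: "face p n X" "X \<noteq> []"
    show "\<sigma> X < p \<and> \<sigma> (map (rot p) X) = Suc (\<sigma> X) mod p"
    proof (cases "S X = {}")
      case True
      then show ?thesis
        using X S_rot[OF X(1)]
        by (cases X) (auto simp: \<sigma>_def rot_snd_def rot_def face_def)
    next
      case False
      have "snd ` S X \<subseteq> {..<p}" using S_sub[of X] by auto
      moreover have "rot_snd p (S X) \<noteq> {}" using False by (simp add: rot_snd_def)
      ultimately show ?thesis
        using \<tau>[OF False _ not_full[OF X(1)]] False S_rot[OF X(1)] by (simp add: \<sigma>_def)
    qed
    have "card (S X) \<le> t * (p - 1)"
    proof -
      have "card {a. (c, a) \<in> S X} \<le> p - 1" for c
      proof -
        have "{a. (c, a) \<in> S X} \<subset> {..<p}"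
          using S_sub[of X] not_full[OF X(1), of c] by auto
        then have "card {a. (c, a) \<in> S X} < card {..<p}"
          by (intro psubset_card_mono) auto
        then show ?thesis by simp
      qed
      then have "(\<Sum>c<t. card {a. (c, a) \<in> S X}) \<le> t * (p - 1)"
        using sum_bounded_above[of "{..<t}" "\<lambda>c. card {a. (c, a) \<in> S X}" "p - 1"] by simp
      moreover have "card (S X) = (\<Sum>c<t. card {a. (c, a) \<in> S X})"
      proof -
        have "finite {a. (c, a) \<in> S X}" for c
          by (rule finite_subset[of _ "{..<p}"]) (use S_sub[of X] in auto)
        then have "card (SIGMA c:{..<t}. {a. (c, a) \<in> S X}) = (\<Sum>c<t. card {a. (c, a) \<in> S X})"
          by simp
        moreover have "(SIGMA c:{..<t}. {a. (c, a) \<in> S X}) = S X"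
          using S_sub[of X] by auto
        ultimately show ?thesis by (simp only:)
      qed
      ultimately show ?thesis by (simp only:)
    qed
    then show "1 \<le> h X \<and> h X \<le> p * (r - 1) + t * (p - 1)"
      using X length_le[OF X(1)] fin_S[of X]
      by (auto simp: h_def Suc_le_eq card_gt_0_iff intro: trans_le_add1)
  next
    fix X Y assume Y: "face p n Y" and X: "X \<noteq> []" and sub: "subseq X Y"
    have "part X a \<subseteq> part Y a" for a
      using set_subseq[OF sub] by (auto simp: part_def)
    then have S_mono: "S X \<subseteq> S Y"
      using nsets_mono[of "part X _" "part Y _"] unfolding S_def by blast
    \<comment> \<open>Equal levels force \<open>X = Y\<close> if neither face has an
      \<open>r\<close>-set in a part, and \<open>S X = S Y\<close> if both do. In the mixed case the
      levels differ.\<close>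
    show "h X \<le> h Y \<and> (h X = h Y \<longrightarrow> \<sigma> X = \<sigma> Y)"
    proof (cases "S Y = {}")
      case True
      then show ?thesis
        using S_mono sub list_emb_length[OF sub] subseq_same_length[OF sub]
        by (auto simp: h_def \<sigma>_def)
    next
      case False
      then have "0 < card (S Y)" using fin_S by (simp add: card_gt_0_iff)
      show ?thesis
      proof (cases "S X = {}")
        case True
        then show ?thesis
          using False length_le[OF face_subseq[OF sub Y]] \<open>0 < card (S Y)\<close>
          by (auto simp: h_def)
      next
        case nonempty: False
        then show ?thesis
          using False card_mono[OF fin_S S_mono] card_subset_eq[OF fin_S S_mono]
          by (auto simp: h_def \<sigma>_def)
      qed
    qed
  qed
  moreover have "n = Suc (p * (r - 1) + t * (p - 1))"
  proof -
    obtain r' t' p' where "r = Suc r'" "t = Suc t'" "p = Suc p'"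
      using \<open>r > 0\<close> \<open>t > 0\<close> \<open>p \<ge> 2\<close> by (metis Suc_pred zero_less_numeral less_le_trans)
    then show ?thesis using n by (simp add: algebra_simps)
  qed
  ultimately show False by simp
qed

lemma kneser_hypergraph_prime:
  fixes f :: "'a set \<Rightarrow> nat"
  assumes "prime p" "r > 0" "t > 0" "finite A" "card A = r * p + (t - 1) * (p - 1)"
    and f: "\<And>F. F \<in> nsets A r \<Longrightarrow> f F < t"
  shows "\<exists>c<t. mono_matching A r p f c"
proof -
  obtain b where "bij_betw b {0..<card A} A"
    using ex_bij_betw_nat_finite[OF \<open>finite A\<close>] by blast
  then have b: "inj_on b {..<card A}" "b ` {..<card A} = A"
    by (auto simp: bij_betw_def lessThan_atLeast0)
  have "b ` F \<in> nsets A r" if "F \<in> nsets {..<card A} r" for F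
    using that b by (auto simp: nsets_def card_image inj_on_subset subset_iff)
  then obtain c where "c < t" "mono_matching {..<card A} r p (\<lambda>F. f (b ` F)) c"
    using kneser_hypergraph_prime_lessThan[OF assms(1,2,3,5), of "\<lambda>F. f (b ` F)"] f by auto
  then show ?thesis using mono_matching_image[of "{..<card A}" r p f b c] b by auto
qed

text \<open>
  The composite case: color each set of suitable size \<open>r'\<close> by the color of a matching of size \<open>k'\<close>
  inside it, and find a monochromatic matching of \<open>p\<close> such sets.
\<close>

theorem kneser_hypergraph:
  fixes f :: "'a set \<Rightarrow> nat"
  assumes "k > 0" "r > 0" "t > 0" "finite A" "card A = r * k + (t - 1) * (k - 1)"
    and "\<And>F. F \<in> nsets A r \<Longrightarrow> f F < t"
  shows "\<exists>c<t. mono_matching A r k f c"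
  using assms
proof (induction k arbitrary: r A f rule: less_induct)
  case (less k)
  show ?case
  proof (cases "k = 1")
    case True
    then have "A \<in> nsets A r" using less.prems by (simp add: nsets_def)
    then have "mono_matching A r k f (f A)"
      unfolding mono_matching_def by (intro exI[of _ "{A}"]) (auto simp: True disjoint_def)
    then show ?thesis using less.prems(6) \<open>A \<in> nsets A r\<close> by blast
  next
    case False
    then obtain p where p: "prime p" "p dvd k" using prime_factor_nat by blast
    then obtain k' where k: "k = p * k'" by blast
    have "k' > 0" "p \<ge> 2" using k less.prems(1) p prime_ge_2_nat by (auto intro: Nat.gr0I)
    then have "k' < k" using k by simp
    define r' where "r' = r * k' + (t - 1) * (k' - 1)"
    have "r' > 0" using \<open>r > 0\<close> \<open>k' > 0\<close> by (simp add: r'_def)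
    have "\<exists>c<t. mono_matching B r k' f c" if "B \<in> nsets A r'" for B
    proof (rule less.IH[OF \<open>k' < k\<close> \<open>k' > 0\<close> \<open>r > 0\<close> \<open>t > 0\<close>])
      show "finite B" "card B = r * k' + (t - 1) * (k' - 1)"
        using that by (auto simp: nsets_def r'_def)
      show "f F < t" if "F \<in> nsets B r" for F
        using that \<open>B \<in> nsets A r'\<close> less.prems(6)[of F] by (auto simp: nsets_def)
    qed
    then obtain g where g: "\<And>B. B \<in> nsets A r' \<Longrightarrow> g B < t \<and> mono_matching B r k' f (g B)"
      by metis
    \<comment> \<open>The surplus terms fit together because (k' - 1) p + (p - 1) = k - 1.\<close>
    have "card A = r' * p + (t - 1) * (p - 1)"
    proof -
      obtain k'' p' t' where "k' = Suc k''" "p = Suc p'" "t = Suc t'"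
        using \<open>k' > 0\<close> \<open>p \<ge> 2\<close> \<open>t > 0\<close> by (metis Suc_pred zero_less_numeral less_le_trans)
      then show ?thesis using less.prems(5) k by (simp add: r'_def algebra_simps)
    qed
    then obtain c where c: "c < t" "mono_matching A r' p g c"
      using kneser_hypergraph_prime[OF p(1) \<open>r' > 0\<close> \<open>t > 0\<close> \<open>finite A\<close>, of g] g by blast
    then obtain M where M: "M \<subseteq> nsets A r'" "card M = p" "disjoint M" "\<forall>B\<in>M. g B = c"
      by (auto simp: mono_matching_def)
    then have "\<forall>B\<in>M. mono_matching B r k' f c" using g by (metis subsetD)
    then obtain N where N: "\<And>B. B \<in> M \<Longrightarrow>
        N B \<subseteq> nsets B r \<and> card (N B) = k' \<and> disjoint (N B) \<and> (\<forall>F\<in>N B. f F = c)"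
      unfolding mono_matching_def by metis
    have "finite M" using M(2) \<open>p \<ge> 2\<close> card.infinite by fastforce
    have fin: "finite (N B)" if "B \<in> M" for B
      using N[OF that] \<open>k' > 0\<close> card.infinite by fastforce
    have F: "F \<subseteq> B" "F \<noteq> {}" if "B \<in> M" "F \<in> N B" for B F
      using N[OF that(1)] that(2) \<open>r > 0\<close> by (auto simp: nsets_def)
    have "N B \<inter> N B' = {}" if "B \<in> M" "B' \<in> M" "B \<noteq> B'" for B B'
      using F that disjointD[OF M(3) that] by blast
    then have "card (\<Union>B\<in>M. N B) = (\<Sum>B\<in>M. card (N B))"
      using \<open>finite M\<close> fin by (intro card_UN_disjoint) auto
    then have "card (\<Union>B\<in>M. N B) = k" using N M(2) k by simp
    moreover have "disjoint (\<Union>B\<in>M. N B)"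
    proof (rule disjointI)
      fix F F' assume "F \<in> (\<Union>B\<in>M. N B)" "F' \<in> (\<Union>B\<in>M. N B)" "F \<noteq> F'"
      then obtain B B' where B: "B \<in> M" "B' \<in> M" "F \<in> N B" "F' \<in> N B'" by blast
      show "F \<inter> F' = {}"
      proof (cases "B = B'")
        case True
        then show ?thesis using N[OF B(1)] B \<open>F \<noteq> F'\<close> by (auto dest: disjointD)
      next
        case False
        then show ?thesis using disjointD[OF M(3) B(1,2)] F(1)[OF B(1,3)] F(1)[OF B(2,4)] by blast
      qed
    qed
    moreover have "(\<Union>B\<in>M. N B) \<subseteq> nsets A r"
      using N M(1) by (fastforce simp: nsets_def)
    moreover have "\<forall>F\<in>(\<Union>B\<in>M. N B). f F = c" using N by blast
    ultimately show ?thesis using c(1) unfolding mono_matching_def by blast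
  qed
qed

text \<open>
  Unequal matching sizes reduce to equal ones by adding \<open>m 0 - m c\<close> dummy points for each color \<open>c\<close>:
  sets containing dummy points get the color of one of these.
\<close>

theorem kneser_hypergraph_asymmetric:
  fixes f :: "'a set \<Rightarrow> nat" and m :: "nat \<Rightarrow> nat"
  assumes "r > 0" "t > 0" and m: "\<And>c. c < t \<Longrightarrow> 1 \<le> m c \<and> m c \<le> m 0"
    and "finite A" "card A = r * m 0 + (\<Sum>c = 1..<t. m c - 1)"
    and f: "\<And>F. F \<in> nsets A r \<Longrightarrow> f F < t"
  shows "\<exists>c<t. mono_matching A r (m c) f c"
proof -
  define D where "D = (SIGMA c:{1..<t}. {..<m 0 - m c})"
  define g where "g = (\<lambda>F :: ('a + nat \<times> nat) set.
    if F \<subseteq> range Inl then f (Inl -` F) else LEAST c. \<exists>x. Inr (c, x) \<in> F)"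
  have fin: "finite (A <+> D)" using \<open>finite A\<close> by (simp add: D_def)
  have "card D = (\<Sum>c = 1..<t. m 0 - m c)" by (simp add: D_def)
  then have "card (A <+> D) = r * m 0 + (\<Sum>c = 1..<t. (m c - 1) + (m 0 - m c))"
    using assms(4,5) by (simp add: card_Plus D_def sum.distrib)
  also have "(\<Sum>c = 1..<t. (m c - 1) + (m 0 - m c)) = (\<Sum>c = 1..<t. m 0 - 1)"
    using m by (intro sum.cong) fastforce+
  finally have card: "card (A <+> D) = r * m 0 + (t - 1) * (m 0 - 1)" by simp
  have Inl_eq: "F = Inl ` (Inl -` F)" if "F \<subseteq> range Inl" for F :: "('a + nat \<times> nat) set"
    using that by auto
  have Inl: "Inl -` F \<in> nsets A r" if F: "F \<in> nsets (A <+> D) r" "F \<subseteq> range Inl" for F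
  proof -
    have "card F = card (Inl -` F)"
      by (rule trans[OF arg_cong[OF Inl_eq[OF F(2)], of card] card_image]) simp
    then show ?thesis
      using F(1) by (auto simp: nsets_def intro: finite_vimageI)
  qed
  have Inr: "\<exists>x. Inr (g F, x) \<in> F" if "\<not> F \<subseteq> range Inl" for F
  proof -
    from that obtain w where "w \<in> F" "w \<notin> range Inl" by blast
    then have "\<exists>c x. Inr (c, x) \<in> F" by (cases w) auto
    then have "\<exists>x. Inr (LEAST c. \<exists>x. Inr (c, x) \<in> F, x) \<in> F" by (rule LeastI_ex)
    then show ?thesis using that by (simp add: g_def)
  qed
  have "g F < t" if "F \<in> nsets (A <+> D) r" for F
  proof (cases "F \<subseteq> range Inl")
    case True
    then show ?thesis using f[OF Inl[OF that]] by (simp add: g_def)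
  next
    case False
    then obtain x where "Inr (g F, x) \<in> F" using Inr by blast
    then show ?thesis using that by (auto simp: nsets_def D_def)
  qed
  moreover have "m 0 > 0" using m[OF \<open>t > 0\<close>] by simp
  ultimately obtain c where c: "c < t" "mono_matching (A <+> D) r (m 0) g c"
    using kneser_hypergraph[OF _ \<open>r > 0\<close> \<open>t > 0\<close> fin card, of g] by blast
  then obtain M where M: "M \<subseteq> nsets (A <+> D) r" "card M = m 0" "disjoint M" "\<forall>F\<in>M. g F = c"
    by (auto simp: mono_matching_def)
  have "finite M" using M(2) \<open>m 0 > 0\<close> card.infinite by fastforce
  define M1 where "M1 = {F \<in> M. F \<subseteq> range Inl}"
  have "\<exists>x. Inr (c, x) \<in> F" if "F \<in> M - M1" for F
    using that Inr[of F] M(4) by (auto simp: M1_def)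
  then obtain x where x: "\<And>F. F \<in> M - M1 \<Longrightarrow> Inr (c, x F) \<in> F" by metis
  \<comment> \<open>Disjoint members of \<open>M\<close> contain different dummy points of color
    \<open>c\<close>, so at most \<open>m 0 - m c\<close> members are lost and \<open>m c\<close>
    remain.\<close>
  have "inj_on x (M - M1)"
  proof (rule inj_onI, rule ccontr)
    fix F G assume FG: "F \<in> M - M1" "G \<in> M - M1" "x F = x G" "F \<noteq> G"
    then have "Inr (c, x F) \<in> F \<inter> G" using x[of F] x[of G] by simp
    then show False using FG disjointD[OF M(3), of F G] by auto
  qed
  moreover have "x ` (M - M1) \<subseteq> {..<m 0 - m c}"
  proof
    fix y assume "y \<in> x ` (M - M1)"
    then obtain F where F: "F \<in> M - M1" "y = x F" by blast
    moreover have "F \<subseteq> A <+> D" using F(1) M(1) by (auto simp: nsets_def)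
    ultimately have "Inr (c, y) \<in> A <+> D" using x[OF F(1)] by auto
    then show "y \<in> {..<m 0 - m c}" by (auto simp: D_def)
  qed
  ultimately have "card (M - M1) \<le> m 0 - m c"
    using card_inj_on_le[of x "M - M1" "{..<m 0 - m c}"] by simp
  moreover have "card (M - M1) = m 0 - card M1"
    using \<open>finite M\<close> M(2) by (subst card_Diff_subset) (auto simp: M1_def)
  moreover have "card M1 \<le> m 0"
    using \<open>finite M\<close> M(2) card_mono[of M M1] by (auto simp: M1_def)
  ultimately have "m c \<le> card M1" using m[OF c(1)] by linarith
  moreover have "mono_matching A r (card M1) f c"
  proof -
    have inj: "inj_on (vimage Inl) M1"
    proof (rule inj_onI)
      fix F G assume FG: "F \<in> M1" "G \<in> M1" "Inl -` F = Inl -` G"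
      have "F = Inl ` (Inl -` F)" using FG(1) by (intro Inl_eq) (simp add: M1_def)
      also have "\<dots> = Inl ` (Inl -` G)" using FG(3) by (rule arg_cong)
      also have "\<dots> = G" using FG(2) by (intro Inl_eq[symmetric]) (simp add: M1_def)
      finally show "F = G" .
    qed
    moreover have "vimage Inl ` M1 \<subseteq> nsets A r" using Inl M(1) by (auto simp: M1_def)
    moreover have "disjoint (vimage Inl ` M1)"
    proof (rule disjointI)
      fix F G assume "F \<in> vimage Inl ` M1" "G \<in> vimage Inl ` M1" "F \<noteq> G"
      then obtain F' G' where "F = Inl -` F'" "G = Inl -` G'" "F' \<in> M" "G' \<in> M" "F' \<noteq> G'"
        by (auto simp: M1_def)
      then show "F \<inter> G = {}" using disjointD[OF M(3), of F' G'] by auto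
    qed
    moreover have "\<forall>F \<in> vimage Inl ` M1. f F = c"
      using M(4) by (auto simp: M1_def g_def)
    ultimately show ?thesis
      unfolding mono_matching_def by (intro exI[of _ "vimage Inl ` M1"]) (simp add: card_image)
  qed
  ultimately show ?thesis using c(1) mono_matching_le by blast
qed

subsection \<open>Kneser Ramsey numbers\<close>

theorem theorem5p1:
  fixes t r :: nat and s :: "nat list" and m :: "nat \<Rightarrow> nat"
  assumes "t \<ge> 2" and "length s = t"
    and "\<And>i. i < t \<Longrightarrow> s ! i \<ge> 3"
    and "\<And>i. i < t \<Longrightarrow> m i = ramsey_number (s[i := s ! i - 1])"
    and "\<And>j. 1 \<le> j \<Longrightarrow> j < t \<Longrightarrow> m j \<le> m 0"
    and "r > 0"
  shows "kneser_ramsey_number r s \<le> (m 0 + 1) * r + (\<Sum>i = 1..<t. m i - 1)"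
  unfolding kneser_ramsey_number_def
proof (rule Least_le)
  define N where "N = (m 0 + 1) * r + (\<Sum>i = 1..<t. m i - 1)"
  \<comment> \<open>The empty vertex set contains no clique of the required sizes, all of which are
    at least 2.\<close>
  have m_pos: "1 \<le> m c" if "c < t" for c
  proof (rule ccontr)
    assume "\<not> 1 \<le> m c"
    then have "ramsey_number (s[c := s ! c - 1]) = 0" using assms(4)[OF that] by simp
    then have "partn_lst ({} :: nat set) (s[c := s ! c - 1]) 2"
      using partn_lst_ramsey_number[of "s[c := s ! c - 1]"] by (metis lessThan_0)
    then obtain i H where "i < t" "H \<in> nsets ({} :: nat set) (s[c := s ! c - 1] ! i)"
      using assms(2) by (auto simp: partn_lst_def monochromatic_def nsets_empty_iff)
    then have "s[c := s ! c - 1] ! i = 0" by (auto simp: nsets_def)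
    then show False
      using assms(3)[OF \<open>i < t\<close>] \<open>i < t\<close> assms(2) by (cases "i = c") auto
  qed
  show "kneser_arrows ((m 0 + 1) * r + (\<Sum>i = 1..<t. m i - 1)) r s"
    unfolding kneser_arrows_def N_def[symmetric]
  proof
    fix f assume f: "f \<in> kneser_edges N r \<rightarrow> {..<length s}"
    \<comment> \<open>Removing the \<open>r\<close> points of \<open>A0\<close> lowers the factor
      \<open>m 0 + 1\<close> to \<open>m 0\<close>, which leaves exactly the number of points that
      the matching theorem asks for.\<close>
    define A0 where "A0 = {1..r}"
    define A where "A = {r<..N}"
    have "r \<le> N" by (simp add: N_def)
    have A0: "A0 \<in> kneser_verts N r"
      using \<open>r \<le> N\<close> by (auto simp: A0_def kneser_verts_def nsets_def)
    have verts: "F \<in> kneser_verts N r \<and> A0 \<inter> F = {}" if "F \<in> nsets A r" for F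
      using that by (fastforce simp: A0_def A_def kneser_verts_def nsets_def)
    have "f {A0, F} < t" if "F \<in> nsets A r" for F
    proof -
      have "{A0, F} \<in> kneser_edges N r"
        using verts[OF that] A0 unfolding kneser_edges_def by blast
      then show ?thesis using f assms(2) by auto
    qed
    moreover have "card A = r * m 0 + (\<Sum>c = 1..<t. m c - 1)"
      by (simp add: A_def N_def algebra_simps)
    moreover have "1 \<le> m c \<and> m c \<le> m 0" if "c < t" for c
      using m_pos[OF that] assms(5)[of c] that by (cases "c = 0") auto
    ultimately obtain c where c: "c < t" "mono_matching A r (m c) (\<lambda>F. f {A0, F}) c"
      using kneser_hypergraph_asymmetric[of r t m A "\<lambda>F. f {A0, F}"] assms(1,6)
      by (auto simp: A_def)
    then obtain M where M: "M \<subseteq> nsets A r" "card M = m c" "disjoint M" "\<forall>F\<in>M. f {A0, F} = c"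
      by (auto simp: mono_matching_def)
    have "finite M" using M(2) m_pos[OF c(1)] card.infinite by fastforce
    \<comment> \<open>Enumerating \<open>M\<close> turns the edges inside it into those of the
      complete graph on \<open>m c\<close> vertices, where Ramsey's theorem applies with the entry
      \<open>c\<close> lowered by 1.\<close>
    then obtain b where b: "inj_on b {..<m c}" "b ` {..<m c} = M"
      using ex_bij_betw_nat_finite[of M] M(2) by (auto simp: bij_betw_def lessThan_atLeast0)
    have edge: "{F, G} \<in> kneser_edges N r" if "F \<in> M" "G \<in> M" "F \<noteq> G" for F G
      using disjointD[OF M(3) that] verts[of F] verts[of G] M(1) that
      unfolding kneser_edges_def by blast
    have edge0: "{A0, F} \<in> kneser_edges N r" if "F \<in> M" for F
      using that verts[of F] M(1) A0 unfolding kneser_edges_def by blast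
    define s' where "s' = s[c := s ! c - 1]"
    have "(\<lambda>e. f (b ` e)) \<in> nsets {..<m c} 2 \<rightarrow> {..<length s'}"
    proof
      fix e assume "e \<in> nsets {..<m c} 2"
      then obtain x y where "e = {x, y}" "x < m c" "y < m c" "x \<noteq> y"
        by (auto elim!: nsets2_E)
      then have "b ` e \<in> kneser_edges N r"
        using edge[of "b x" "b y"] b by (auto simp: inj_on_def)
      then show "f (b ` e) \<in> {..<length s'}" using f by (auto simp: s'_def)
    qed
    moreover have "partn_lst {..<m c} s' 2"
      using partn_lst_ramsey_number assms(4)[OF c(1)] by (simp add: s'_def)
    ultimately obtain i H where i: "i < t" and H: "H \<in> nsets {..<m c} (s' ! i)"
      and Hi: "\<And>e. e \<in> nsets H 2 \<Longrightarrow> f (b ` e) = i"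
      using assms(2) by (fastforce simp: partn_lst_def monochromatic_def s'_def)
    define K where "K = b ` H"
    have K: "K \<subseteq> M" "finite K" "card K = s' ! i"
      using H b card_image[OF inj_on_subset[OF b(1)], of H] by (auto simp: nsets_def K_def)
    have fK: "f {F, G} = i" if FG: "F \<in> K" "G \<in> K" "F \<noteq> G" for F G
    proof -
      obtain x y where "x \<in> H" "y \<in> H" "F = b x" "G = b y" using FG by (auto simp: K_def)
      then show ?thesis using Hi[of "{x, y}"] FG(3) by auto
    qed
    have "A0 \<notin> M"
    proof
      assume "A0 \<in> M"
      then have "A0 = {}" using verts[of A0] M(1) by auto
      then show False using \<open>r > 0\<close> by (simp add: A0_def)
    qed
    \<comment> \<open>A clique of color \<open>c\<close> is one vertex short, and \<open>A0\<close>
      completes it since it is joined to all of \<open>M\<close> in color \<open>c\<close>. In any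
      other color the size is already right.\<close>
    define K' where "K' = (if i = c then insert A0 K else K)"
    have "card K' = s ! i"
    proof (cases "i = c")
      case True
      have "A0 \<notin> K" using K(1) \<open>A0 \<notin> M\<close> by blast
      then have "card K' = Suc (s ! i - 1)"
        using True K(2,3) i assms(2) by (simp add: K'_def s'_def)
      then show ?thesis using assms(3)[OF i] by simp
    qed (use K(3) in \<open>simp add: K'_def s'_def\<close>)
    moreover have "M \<subseteq> kneser_verts N r"
      using M(1) verts by blast
    then have "K' \<subseteq> kneser_verts N r"
      using K(1) A0 by (simp add: K'_def)
    ultimately have "K' \<in> nsets (kneser_verts N r) (s ! i)"
      using K by (simp add: nsets_def K'_def)
    moreover have pair: "{F, G} \<in> kneser_edges N r \<and> f {F, G} = i"
      if FG: "F \<in> K'" "G \<in> K'" "F \<noteq> G" for F G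
    proof -
      consider "F \<in> K" "G \<in> K" | "i = c" "F = A0" "G \<in> K" | "i = c" "G = A0" "F \<in> K"
        using FG by (auto simp: K'_def split: if_splits)
      then show ?thesis
      proof cases
        case 1
        then show ?thesis using edge[of F G] fK[of F G] K(1) \<open>F \<noteq> G\<close> by blast
      next
        case 2
        then show ?thesis using edge0[of G] M(4) K(1) by blast
      next
        case 3
        then have "{F, G} = {A0, F}" by blast
        then show ?thesis using 3 edge0[of F] M(4) K(1) by (simp only:) blast
      qed
    qed
    then have "clique K' (kneser_edges N r)" by (simp add: clique_def)
    moreover have "\<forall>e \<in> nsets K' 2. f e = i"
      using pair by (auto elim!: nsets2_E)
    ultimately show "\<exists>i<length s. \<exists>K\<in>nsets (kneser_verts N r) (s ! i).
        clique K (kneser_edges N r) \<and> (\<forall>e\<in>nsets K 2. f e = i)"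
      using i assms(2) by blast
  qed
qed

end
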